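(* The set $B(\bar O^2)$ of all numbers with bounded $\bar O^2$-symbols has Hausdorff dimension zero: $\dim_H B(\bar O^2)=0$.
   Context: $\mathbb N=\{1,2,3,\dots\}$. For a sequence $(d_k)_{k\ge1}$ of positive integers put $q_1=d_1$ and $q_{k+1}=q_k(q_k+1)-1+d_{k+1}$ for $k\ge1$, and define $\bar O^2(d_1,d_2,\dots)=\sum_{n\ge1}\frac{(-1)^{n-1}}{q_n}$. Every irrational $x\in(0,1)$ is uniquely of the form $x=\bar O^2(d_1(x),d_2(x),\dots)$; the numbers $d_k(x)$ are its $\bar O^2$-symbols. $B(\bar O^2)$ is the set of all $x=\bar O^2(d_1(x),d_2(x),\dots)$ for which there exists $K(x)\in\mathbb N$ with $d_j(x)\le K(x)$ for all $j\in\mathbb N$. *)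

theory Defs
  imports "HOL-Analysis.Analysis"
begin

section \<open>Hausdorff measure and Hausdorff dimension\<close>

text \<open>The value \<open>|U|\<^sup>s\<close> of a covering set.  Since \<open>0 powr 0 = 0\<close>, the case \<open>s = 0\<close> is given
  explicitly, so that the measure of dimension \<open>0\<close> is the counting measure.\<close>

definition hausdorff_gauge :: "real \<Rightarrow> 'a::metric_space set \<Rightarrow> ennreal" where
  "hausdorff_gauge s U =
     (if U = {} then 0 else if s = 0 then 1 else ennreal (diameter U powr s))"

text \<open>Boundedness is required explicitly because \<open>diameter U = 0\<close> for unbounded \<open>U\<close>.
  Finite covers are included, as \<open>U i\<close> may be empty.\<close>

definition hausdorff_covers :: "real \<Rightarrow> 'a::metric_space set \<Rightarrow> (nat \<Rightarrow> 'a set) set" where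
  "hausdorff_covers \<delta> A =
     {U. A \<subseteq> (\<Union>i. U i) \<and> (\<forall>i. bounded (U i) \<and> diameter (U i) \<le> \<delta>)}"

definition hausdorff_measure :: "real \<Rightarrow> 'a::metric_space set \<Rightarrow> ennreal" where
  "hausdorff_measure s A =
     (SUP \<delta>\<in>{0<..}. INF U\<in>hausdorff_covers \<delta> A. \<Sum>i. hausdorff_gauge s (U i))"

definition hausdorff_dim :: "'a::metric_space set \<Rightarrow> ennreal" where
  "hausdorff_dim A = Inf {ennreal s | s. s \<ge> 0 \<and> hausdorff_measure s A = 0}"

section \<open>The \<open>O\<^sup>2\<close>-bar expansion\<close>

text \<open>Sequences are indexed from \<open>0\<close>: \<open>d k\<close> and \<open>O2_denom d k\<close> stand for \<open>d\<^bsub>k+1\<^esub>\<close> and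
  \<open>q\<^bsub>k+1\<^esub>\<close>.  For positive \<open>d\<close> the subtraction is never truncated, because all
  denominators are positive.\<close>

primrec O2_denom :: "(nat \<Rightarrow> nat) \<Rightarrow> nat \<Rightarrow> nat" where
  "O2_denom d 0 = d 0"
| "O2_denom d (Suc k) = O2_denom d k * (O2_denom d k + 1) - 1 + d (Suc k)"

definition O2_bar :: "(nat \<Rightarrow> nat) \<Rightarrow> real" where
  "O2_bar d = (\<Sum>n. (-1) ^ n / real (O2_denom d n))"

definition O2_bounded :: "real set" where
  "O2_bounded = {x. \<exists>d. (\<forall>k. d k \<ge> 1) \<and> x = O2_bar d \<and> (\<exists>K. \<forall>j. d j \<le> K)}"

lemma O2_denom_ge:
  assumes "\<And>k. d k \<ge> 1"
  shows "O2_denom d n \<ge> 2 ^ n"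
proof (induction n)
  case 0
  show ?case using assms by simp
next
  case (Suc n)
  define q where "q = O2_denom d n"
  have q: "q \<ge> 2 ^ n" "q \<ge> 1"
    using Suc order_trans[OF one_le_power[of "2::nat" n]] by (auto simp: q_def)
  have "2 * q \<le> q * (q + 1)"
    using q(2) by (simp add: mult.commute)
  also have "\<dots> \<le> q * (q + 1) - 1 + d (Suc n)"
    using assms[of "Suc n"] by linarith
  finally show ?case using q(1) by (simp add: q_def)
qed

text \<open>The series defining \<open>O2_bar d\<close> converges for every sequence of positive integers.\<close>

lemma summable_O2_bar:
  assumes "\<And>k. d k \<ge> 1"
  shows "summable (\<lambda>n. (-1) ^ n / real (O2_denom d n))"
proof (rule summable_comparison_test')
  show "summable (\<lambda>n. (1 / 2 :: real) ^ n)" by (simp add: summable_geometric)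
  show "norm ((-1) ^ n / real (O2_denom d n)) \<le> (1 / 2) ^ n" if "n \<ge> 0" for n
  proof -
    have "real (2 ^ n) \<le> real (O2_denom d n)"
      using O2_denom_ge[OF assms, of n] by (simp only: of_nat_le_iff)
    then have "(2::real) ^ n \<le> real (O2_denom d n)" by simp
    then have "1 / real (O2_denom d n) \<le> 1 / 2 ^ n"
      by (rule frac_le[OF zero_le_one order_refl zero_less_power[OF zero_less_numeral]])
    then show ?thesis by (simp add: power_one_over norm_divide norm_power)
  qed
qed

end

theory Submission
  imports Defs "HOL-Real_Asymp.Real_Asymp"
begin

text \<open>
  The denominators satisfy \<open>q\<^bsub>k+1\<^esub> \<ge> q\<^bsub>k\<^esub>\<^sup>2\<close> and \<open>q\<^bsub>2\<^esub> \<ge> 2\<close>, so they grow doubly exponentially however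
  small the symbols are.  A number is therefore determined by its first \<open>n + 1\<close> symbols up to an error of
  order \<open>2 powr (- (2 ^ n))\<close> (\<open>dist_O2_bar_le\<close>).  If all symbols are at most \<open>K\<close>, only \<open>K ^ (n + 1)\<close>
  words of length \<open>n + 1\<close> occur, and for every \<open>s > 0\<close> this merely exponential number of cylinders is
  overwhelmed by the \<open>s\<close>-th power of their diameter.  Hence the numbers with symbols at most \<open>K\<close>
  form a null set for the \<open>s\<close>-dimensional Hausdorff measure (\<open>hausdorff_measure_O2_bar_le\<close>).  The
  set of numbers with bounded symbols is the union of these sets over all \<open>K\<close>, and a countable
  union of null sets is null (\<open>hausdorff_measure_UN_eq_0\<close>).
\<close>

section \<open>Null sets of Hausdorff measures\<close>

lemma hausdorff_measure_eq_0I: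
  assumes "\<And>\<delta> e. \<delta> > 0 \<Longrightarrow> e > 0 \<Longrightarrow>
    \<exists>U\<in>hausdorff_covers \<delta> A. (\<Sum>i. hausdorff_gauge s (U i)) \<le> ennreal e"
  shows "hausdorff_measure s A = 0"
proof -
  have "(INF U\<in>hausdorff_covers \<delta> A. \<Sum>i. hausdorff_gauge s (U i)) \<le> 0" if "\<delta> > 0" for \<delta>
  proof (rule ennreal_le_epsilon)
    fix e :: real assume "e > 0"
    with assms[OF that] obtain U where "U \<in> hausdorff_covers \<delta> A"
      "(\<Sum>i. hausdorff_gauge s (U i)) \<le> ennreal e" by blast
    then show "(INF U\<in>hausdorff_covers \<delta> A. \<Sum>i. hausdorff_gauge s (U i)) \<le> 0 + ennreal e"
      by (auto intro: INF_lower2)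
  qed
  then have "hausdorff_measure s A \<le> 0"
    unfolding hausdorff_measure_def by (auto intro!: SUP_least)
  then show ?thesis by simp
qed

lemma hausdorff_measure_eq_0D:
  assumes "hausdorff_measure s A = 0" "\<delta> > 0" "e > 0"
  shows "\<exists>U\<in>hausdorff_covers \<delta> A. (\<Sum>i. hausdorff_gauge s (U i)) < ennreal e"
proof -
  have "(INF U\<in>hausdorff_covers \<delta> A. \<Sum>i. hausdorff_gauge s (U i)) \<le> hausdorff_measure s A"
    unfolding hausdorff_measure_def using assms(2) by (intro SUP_upper) simp
  also have "\<dots> < ennreal e"
    using assms by simp
  finally show ?thesis
    by (simp add: INF_less_iff)
qed

text \<open>Covers of the members with total gauges \<open>e / 2\<close>, \<open>e / 4\<close>, \<open>\<dots>\<close> are merged into a single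
  sequence through the enumeration of pairs of natural numbers.\<close>

lemma hausdorff_measure_UN_eq_0:
  fixes A :: "nat \<Rightarrow> 'a::metric_space set"
  assumes "\<And>m. hausdorff_measure s (A m) = 0"
  shows "hausdorff_measure s (\<Union>m. A m) = 0"
proof (rule hausdorff_measure_eq_0I)
  fix \<delta> e :: real assume "\<delta> > 0" "e > 0"
  then have "\<exists>U\<in>hausdorff_covers \<delta> (A m).
      (\<Sum>i. hausdorff_gauge s (U i)) < ennreal (e * (1 / 2) ^ Suc m)" for m
    by (intro hausdorff_measure_eq_0D assms) auto
  then obtain U where cover: "\<And>m. U m \<in> hausdorff_covers \<delta> (A m)"
    and small: "\<And>m. (\<Sum>i. hausdorff_gauge s (U m i)) < ennreal (e * (1 / 2) ^ Suc m)"
    by metis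
  define V where "V i = (case prod_decode i of (m, n) \<Rightarrow> U m n)" for i
  have "(\<Union>m. A m) \<subseteq> (\<Union>i. V i)"
  proof
    fix x assume "x \<in> (\<Union>m. A m)"
    then obtain m n where "x \<in> U m n"
      using cover by (fastforce simp: hausdorff_covers_def)
    then have "x \<in> V (prod_encode (m, n))"
      by (simp add: V_def)
    then show "x \<in> (\<Union>i. V i)" by blast
  qed
  moreover have "bounded (V i) \<and> diameter (V i) \<le> \<delta>" for i
    using cover by (auto simp: V_def hausdorff_covers_def split: prod.split)
  ultimately have "V \<in> hausdorff_covers \<delta> (\<Union>m. A m)"
    by (simp add: hausdorff_covers_def)
  moreover have "(\<Sum>i. hausdorff_gauge s (V i)) \<le> ennreal e"
  proof -
    have "(\<Sum>i. hausdorff_gauge s (V i)) =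
        (\<Sum>i. (\<lambda>(m, n). hausdorff_gauge s (U m n)) (prod_decode i))"
      by (simp add: V_def case_prod_beta)
    also have "\<dots> = (\<Sum>m. \<Sum>n. hausdorff_gauge s (U m n))"
      by (rule suminf_ennreal_2dimen) simp
    also have "\<dots> \<le> (\<Sum>m. ennreal (e * (1 / 2) ^ Suc m))"
      using small by (intro suminf_le less_imp_le) auto
    also have "\<dots> = ennreal e"
      using \<open>e > 0\<close> sums_mult[OF power_half_series, of e]
      by (intro sums_unique[symmetric] sums_ennreal[THEN iffD2]) auto
    finally show ?thesis .
  qed
  ultimately show "\<exists>U\<in>hausdorff_covers \<delta> (\<Union>m. A m).
      (\<Sum>i. hausdorff_gauge s (U i)) \<le> ennreal e" by blast
qed

lemma hausdorff_gauge_le: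
  assumes "s > 0" "bounded U" "diameter U \<le> r"
  shows "hausdorff_gauge s U \<le> ennreal (r powr s)"
  using assms diameter_ge_0[of U]
  by (auto simp: hausdorff_gauge_def intro!: ennreal_leI powr_mono2)

text \<open>A finite cover becomes an infinite one by padding with empty sets, whose gauge is \<open>0\<close>.\<close>

lemma finite_cover_imp_hausdorff_cover:
  assumes "finite F" "A \<subseteq> \<Union>F" "s > 0" "r \<ge> 0" "r \<le> \<delta>"
    and F: "\<And>C. C \<in> F \<Longrightarrow> bounded C \<and> diameter C \<le> r"
  shows "\<exists>U\<in>hausdorff_covers \<delta> A.
    (\<Sum>i. hausdorff_gauge s (U i)) \<le> ennreal (real (card F) * r powr s)"
proof -
  obtain h where h: "bij_betw h {0..<card F} F"
    using ex_bij_betw_nat_finite[OF \<open>finite F\<close>] by blast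
  define U where "U i = (if i < card F then h i else {})" for i
  have U: "bounded (U i) \<and> diameter (U i) \<le> r" for i
    using F bij_betwE[OF h] \<open>r \<ge> 0\<close> by (auto simp: U_def)
  have "\<Union>F \<subseteq> (\<Union>i. U i)"
    using bij_betw_imp_surj_on[OF h] by (force simp: U_def)
  then have "U \<in> hausdorff_covers \<delta> A"
    using assms(2) order_trans[OF _ \<open>r \<le> \<delta>\<close>] U by (auto simp: hausdorff_covers_def)
  moreover have "(\<Sum>i. hausdorff_gauge s (U i)) \<le> ennreal (real (card F) * r powr s)"
  proof -
    have "(\<Sum>i. hausdorff_gauge s (U i)) = (\<Sum>i<card F. hausdorff_gauge s (U i))"
      by (intro suminf_finite) (auto simp: U_def hausdorff_gauge_def)
    also have "\<dots> \<le> (\<Sum>i<card F. ennreal (r powr s))"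
      using U \<open>s > 0\<close> by (intro sum_mono hausdorff_gauge_le) auto
    also have "\<dots> = ennreal (real (card F) * r powr s)"
      by (simp add: ennreal_mult ennreal_of_nat_eq_real_of_nat)
    finally show ?thesis .
  qed
  ultimately show ?thesis by blast
qed

text \<open>Both limits are used at the same index: a single late cover meets the
  bound \<open>\<delta>\<close> on the diameters and has small total gauge.\<close>

lemma hausdorff_measure_eq_0_if_finite_covers:
  fixes F :: "nat \<Rightarrow> 'a::metric_space set set"
  assumes "s > 0" "\<And>n. finite (F n)" "\<And>n. A \<subseteq> \<Union>(F n)" "\<And>n. r n \<ge> 0"
    and F: "\<And>n C. C \<in> F n \<Longrightarrow> bounded C \<and> diameter C \<le> r n"
    and "r \<longlonglongrightarrow> 0" "(\<lambda>n. real (card (F n)) * r n powr s) \<longlonglongrightarrow> 0"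
  shows "hausdorff_measure s A = 0"
proof (rule hausdorff_measure_eq_0I)
  fix \<delta> e :: real assume "\<delta> > 0" "e > 0"
  then have "\<forall>\<^sub>F n in sequentially. r n < \<delta> \<and> real (card (F n)) * r n powr s < e"
    using assms(6,7) by (intro eventually_conj order_tendstoD(2))
  then obtain n where n: "r n < \<delta>" "real (card (F n)) * r n powr s < e"
    by (auto simp: eventually_sequentially)
  obtain U where "U \<in> hausdorff_covers \<delta> A"
    "(\<Sum>i. hausdorff_gauge s (U i)) \<le> ennreal (real (card (F n)) * r n powr s)"
    using finite_cover_imp_hausdorff_cover[OF assms(2,3,1,4) less_imp_le[OF n(1)]] F by blast
  with n(2) show "\<exists>U\<in>hausdorff_covers \<delta> A. (\<Sum>i. hausdorff_gauge s (U i)) \<le> ennreal e"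
    by (meson ennreal_leI less_imp_le order_trans)
qed

section \<open>Growth of the denominators\<close>

lemma O2_denom_pos:
  assumes "\<And>k. d k \<ge> 1"
  shows "O2_denom d n > 0"
  using O2_denom_ge[of d n, OF assms] by (meson less_le_trans zero_less_numeral zero_less_power)

lemma O2_denom_Suc_ge:
  assumes "\<And>k. d k \<ge> 1"
  shows "O2_denom d (Suc n) \<ge> O2_denom d n * (O2_denom d n + 1)"
  using assms[of "Suc n"] by simp

lemma O2_denom_add_ge:
  assumes "\<And>k. d k \<ge> 1"
  shows "O2_denom d (n + k) \<ge> O2_denom d n * 2 ^ k"
proof (induction k)
  case (Suc k)
  have "O2_denom d n * 2 ^ Suc k \<le> O2_denom d (n + k) * 2"
    using Suc by simp
  also have "\<dots> \<le> O2_denom d (n + k) * (O2_denom d (n + k) + 1)"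
    using O2_denom_pos[of d "n + k", OF assms] by (intro mult_left_mono) auto
  also have "\<dots> \<le> O2_denom d (n + Suc k)"
    using O2_denom_Suc_ge[of d "n + k", OF assms] by simp
  finally show ?case .
qed simp

text \<open>Squaring the denominator at each step doubles the exponent; the index is shifted because the
  initial denominator may be \<open>1\<close>, which squaring does not increase.\<close>

lemma O2_denom_Suc_ge_double_exp:
  assumes "\<And>k. d k \<ge> 1"
  shows "O2_denom d (Suc n) \<ge> 2 ^ 2 ^ n"
proof (induction n)
  case 0
  show ?case using O2_denom_ge[of d 1, OF assms] by simp
next
  case (Suc n)
  have "(2::nat) ^ 2 ^ Suc n = 2 ^ 2 ^ n * 2 ^ 2 ^ n"
    by (simp add: mult_2 power_add)
  also have "\<dots> \<le> O2_denom d (Suc n) * (O2_denom d (Suc n) + 1)"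
    using Suc by (intro mult_mono) auto
  also have "\<dots> \<le> O2_denom d (Suc (Suc n))"
    by (rule O2_denom_Suc_ge[of d, OF assms])
  finally show ?case .
qed

lemma O2_denom_cong:
  assumes "\<And>i. i \<le> k \<Longrightarrow> d i = d' i"
  shows "O2_denom d k = O2_denom d' k"
  using assms by (induction k) auto

section \<open>Cylinders\<close>

text \<open>Denominators at least double at each step, so the tail of the series is dominated by a
  geometric series with ratio \<open>1 / 2\<close>.\<close>

lemma O2_bar_partial_sum_error:
  assumes "\<And>k. d k \<ge> 1"
  shows "\<bar>O2_bar d - (\<Sum>k<n. (-1) ^ k / real (O2_denom d k))\<bar> \<le> 2 / real (O2_denom d n)"
proof -
  define f where "f k = (-1) ^ k / real (O2_denom d k)" for k
  have sf: "summable f"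
    unfolding f_def by (rule summable_O2_bar[of d, OF assms])
  have "norm (f (k + n)) \<le> 1 / real (O2_denom d n) * (1 / 2) ^ k" for k
  proof -
    have "real (O2_denom d n * 2 ^ k) \<le> real (O2_denom d (k + n))"
      using O2_denom_add_ge[of d n k, OF assms] by (simp only: of_nat_le_iff add.commute)
    then have "1 / real (O2_denom d (k + n)) \<le> 1 / real (O2_denom d n * 2 ^ k)"
      using O2_denom_pos[of d n, OF assms] by (intro frac_le) auto
    then show ?thesis
      by (simp add: f_def norm_divide norm_power power_one_over)
  qed
  moreover have "(\<lambda>k. 1 / real (O2_denom d n) * (1 / 2) ^ k) sums (1 / real (O2_denom d n) * 2)"
    using geometric_sums[of "1 / 2 :: real"] by (intro sums_mult) simp
  ultimately have "norm (\<Sum>k. f (k + n)) \<le> 1 / real (O2_denom d n) * 2"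
    using norm_suminf_le[of "\<lambda>k. f (k + n)" "\<lambda>k. 1 / real (O2_denom d n) * (1 / 2) ^ k"]
    by (simp add: sums_iff)
  moreover have "O2_bar d - (\<Sum>k<n. f k) = (\<Sum>k. f (k + n))"
    using suminf_split_initial_segment[OF sf, of n] by (simp add: O2_bar_def flip: f_def)
  ultimately show ?thesis
    by (simp add: f_def)
qed

text \<open>Both expansions share the partial sum of their first \<open>Suc n\<close> terms, and each is within
  \<open>2 / 2 ^ 2 ^ n\<close> of it.\<close>

lemma dist_O2_bar_le:
  assumes "\<And>k. d k \<ge> 1" "\<And>k. d' k \<ge> 1" "\<And>i. i < Suc n \<Longrightarrow> d i = d' i"
  shows "dist (O2_bar d) (O2_bar d') \<le> 4 / 2 ^ 2 ^ n"
proof -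
  have error: "\<bar>O2_bar d - (\<Sum>k<Suc n. (-1) ^ k / real (O2_denom d k))\<bar> \<le> 2 / 2 ^ 2 ^ n"
    if d: "\<And>k. d k \<ge> 1" for d
  proof -
    have "real (2 ^ 2 ^ n) \<le> real (O2_denom d (Suc n))"
      using O2_denom_Suc_ge_double_exp[of d n, OF d] by (simp only: of_nat_le_iff)
    then have "2 / real (O2_denom d (Suc n)) \<le> 2 / 2 ^ 2 ^ n"
      by (intro frac_le) auto
    with O2_bar_partial_sum_error[of d "Suc n", OF d] show ?thesis by linarith
  qed
  have "(\<Sum>k<Suc n. (-1) ^ k / real (O2_denom d k)) =
      (\<Sum>k<Suc n. (-1) ^ k / real (O2_denom d' k))"
  proof (rule sum.cong[OF refl])
    fix k assume "k \<in> {..<Suc n}"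
    then have "O2_denom d k = O2_denom d' k"
      by (intro O2_denom_cong assms(3)) auto
    then show "(-1) ^ k / real (O2_denom d k) = (-1) ^ k / real (O2_denom d' k)" by simp
  qed
  with error[of d, OF assms(1)] error[of d', OF assms(2)] show ?thesis
    unfolding dist_real_def by linarith
qed

definition O2_cylinder :: "nat list \<Rightarrow> real set" where
  "O2_cylinder w = {O2_bar d | d. (\<forall>k. d k \<ge> 1) \<and> map d [0..<length w] = w}"

lemma O2_cylinder_small:
  assumes "length w = Suc n"
  shows "bounded (O2_cylinder w) \<and> diameter (O2_cylinder w) \<le> 4 / 2 ^ 2 ^ n"
proof
  have dist: "dist x y \<le> 4 / 2 ^ 2 ^ n" if "x \<in> O2_cylinder w" "y \<in> O2_cylinder w" for x y
  proof -
    from that obtain d d' where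
      d: "x = O2_bar d" "\<And>k. d k \<ge> 1" "map d [0..<Suc n] = w" and
      d': "y = O2_bar d'" "\<And>k. d' k \<ge> 1" "map d' [0..<Suc n] = w"
      using assms by (auto simp: O2_cylinder_def)
    have "d i = d' i" if "i < Suc n" for i
      using d(3) d'(3) that by (metis add_0 diff_zero length_upt nth_map nth_upt)
    then show ?thesis
      using d d' by (auto intro: dist_O2_bar_le)
  qed
  then show "bounded (O2_cylinder w)"
    by (meson bounded_two_points)
  show "diameter (O2_cylinder w) \<le> 4 / 2 ^ 2 ^ n"
    using dist by (intro diameter_le) (auto simp: dist_norm)
qed

section \<open>Numbers with bounded symbols\<close>

text \<open>The logarithm of the first factor is linear in \<open>n\<close>, that of the second is a constant minus
  a positive multiple of \<open>2 ^ n\<close>.  The proof passes to exponentials to expose these logarithms.\<close>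

lemma card_cylinders_tendsto_0:
  fixes c s :: real
  assumes "c > 1" "s > 0"
  shows "(\<lambda>n. c ^ Suc n * (4 / 2 ^ 2 ^ n) powr s) \<longlonglongrightarrow> 0"
proof -
  have "(\<lambda>n. exp (Suc n * ln c) * (4 * exp (- ln 2 * exp (n * ln 2))) powr s) \<longlonglongrightarrow> 0"
    using assms by real_asymp
  moreover have "exp (Suc n * ln c) * (4 * exp (- ln 2 * exp (n * ln 2))) powr s =
      c ^ Suc n * (4 / 2 ^ 2 ^ n) powr s" for n
  proof -
    have exp_mult_ln: "exp (real m * ln b) = b ^ m" if "b > 0" for m and b :: real
      using that by (simp add: exp_of_nat_mult)
    have "exp (- ln 2 * exp (n * ln 2)) = exp (- (real (2 ^ n) * ln 2))"
      by (simp add: exp_mult_ln mult.commute)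
    also have "\<dots> = 1 / 2 ^ 2 ^ n"
      by (subst exp_minus, subst exp_mult_ln) (auto simp: field_simps)
    finally show ?thesis
      using exp_mult_ln[of c "Suc n"] assms by simp
  qed
  ultimately show ?thesis by simp
qed

text \<open>The covers are the families of cylinders of the \<open>K ^ Suc n\<close> words of length \<open>Suc n\<close> over
  \<open>{1..K}\<close>.\<close>

lemma hausdorff_measure_O2_bar_le:
  assumes "s > 0"
  shows "hausdorff_measure s {O2_bar d | d. \<forall>k. d k \<in> {1..K}} = 0"
proof -
  define W where "W n = {w. set w \<subseteq> {1..K} \<and> length w = Suc n}" for n
  have finW: "finite (W n)" for n
    unfolding W_def by (rule finite_lists_length_eq) simp
  have cardW: "card (W n) = K ^ Suc n" for n
    unfolding W_def by (subst card_lists_length_eq) auto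
  show ?thesis
  proof (rule hausdorff_measure_eq_0_if_finite_covers
      [where F = "\<lambda>n. O2_cylinder ` W n" and r = "\<lambda>n. 4 / 2 ^ 2 ^ n", OF assms])
    fix n
    show "finite (O2_cylinder ` W n)" using finW by simp
    show "{O2_bar d | d. \<forall>k. d k \<in> {1..K}} \<subseteq> \<Union>(O2_cylinder ` W n)"
    proof safe
      fix d :: "nat \<Rightarrow> nat" assume d: "\<forall>k. d k \<in> {1..K}"
      then have "map d [0..<Suc n] \<in> W n"
        unfolding W_def by (auto simp del: upt_Suc)
      moreover have "O2_bar d \<in> O2_cylinder (map d [0..<Suc n])"
        unfolding O2_cylinder_def mem_Collect_eq
        by (rule exI[of _ d]) (use d in \<open>simp del: upt_Suc\<close>)
      ultimately show "O2_bar d \<in> \<Union>(O2_cylinder ` W n)" by blast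
    qed
    show "(4 :: real) / 2 ^ 2 ^ n \<ge> 0" by simp
    show "bounded C \<and> diameter C \<le> 4 / 2 ^ 2 ^ n" if "C \<in> O2_cylinder ` W n" for C
    proof -
      from that obtain w where w: "C = O2_cylinder w" "length w = Suc n"
        unfolding W_def by blast
      then show ?thesis
        using O2_cylinder_small[of w n] by blast
    qed
  next
    show "(\<lambda>n. 4 / 2 ^ 2 ^ n :: real) \<longlonglongrightarrow> 0" by real_asymp
    \<comment> \<open>Enlarging the count to a power of \<open>K + 2\<close> makes the base exceed \<open>1\<close> for every \<open>K\<close>.\<close>
    have count: "real (card (O2_cylinder ` W n)) \<le> real (K + 2) ^ Suc n" for n
    proof -
      have "card (O2_cylinder ` W n) \<le> K ^ Suc n"
        using card_image_le[OF finW, of O2_cylinder n] by (simp only: cardW)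
      also have "\<dots> \<le> (K + 2) ^ Suc n"
        by (rule power_mono) auto
      finally have "real (card (O2_cylinder ` W n)) \<le> real ((K + 2) ^ Suc n)"
        by (rule of_nat_mono)
      then show ?thesis
        by (simp only: of_nat_power)
    qed
    show "(\<lambda>n. real (card (O2_cylinder ` W n)) * (4 / 2 ^ 2 ^ n) powr s) \<longlonglongrightarrow> 0"
    proof (rule Lim_null_comparison)
      show "(\<lambda>n. real (K + 2) ^ Suc n * (4 / 2 ^ 2 ^ n) powr s) \<longlonglongrightarrow> 0"
        using assms by (intro card_cylinders_tendsto_0) auto
      have "norm (real (card (O2_cylinder ` W n)) * (4 / 2 ^ 2 ^ n) powr s) \<le>
          real (K + 2) ^ Suc n * (4 / 2 ^ 2 ^ n) powr s" for n
        unfolding real_norm_def abs_mult abs_of_nat abs_of_nonneg[OF powr_ge_zero]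
        by (rule mult_right_mono[OF count powr_ge_zero])
      then show "\<forall>\<^sub>F n in sequentially. norm (real (card (O2_cylinder ` W n)) * (4 / 2 ^ 2 ^ n) powr s) \<le>
          real (K + 2) ^ Suc n * (4 / 2 ^ 2 ^ n) powr s"
        by (intro always_eventually allI)
    qed
  qed
qed

theorem theorem10:
  shows "hausdorff_dim O2_bounded = 0"
proof -
  have union: "O2_bounded = (\<Union>K. {O2_bar d | d. \<forall>k. d k \<in> {1..K}})"
  proof (intro set_eqI iffI)
    fix x assume "x \<in> O2_bounded"
    then obtain d K where "\<forall>k. d k \<ge> 1" and x: "x = O2_bar d" and "\<forall>k. d k \<le> K"
      unfolding O2_bounded_def by (elim CollectE exE conjE)
    then have "\<forall>k. d k \<in> {1..K}" by simp
    with x show "x \<in> (\<Union>K. {O2_bar d | d. \<forall>k. d k \<in> {1..K}})"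
      by (intro UN_I[OF UNIV_I] CollectI exI conjI)
  next
    fix x assume "x \<in> (\<Union>K. {O2_bar d | d. \<forall>k. d k \<in> {1..K}})"
    then obtain d K where x: "x = O2_bar d" and "\<forall>k. d k \<in> {1..K}"
      by (elim UN_E CollectE exE conjE)
    then have "\<forall>k. d k \<ge> 1" "\<forall>k. d k \<le> K" by auto
    with x show "x \<in> O2_bounded"
      unfolding O2_bounded_def by (intro CollectI exI conjI)
  qed
  have "hausdorff_dim O2_bounded \<le> 0"
  proof (rule ennreal_le_epsilon)
    fix s :: real assume "s > 0"
    then have "hausdorff_measure s O2_bounded = 0"
      unfolding union by (rule hausdorff_measure_UN_eq_0[OF hausdorff_measure_O2_bar_le])
    with \<open>s > 0\<close> have "ennreal s \<in> {ennreal s | s. s \<ge> 0 \<and> hausdorff_measure s O2_bounded = 0}"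
      by (intro CollectI exI[of _ s]) simp
    then show "hausdorff_dim O2_bounded \<le> 0 + ennreal s"
      unfolding hausdorff_dim_def add_0 by (rule Inf_lower)
  qed
  then show ?thesis by simp
qed

end
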